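(* Let $P=\bigcap_{i=1}^N\{l_i>0\}\subset\mathbb R^n$ be a simple convex polytope with $l_1,\dots,l_N$ affine functions, such that $l_1(x)=x_1,\dots,l_n(x)=x_n$ and $0$ is a vertex of $P$, and let $0<h\in C^\infty(\overline P)$. Suppose $u$ satisfies $$\det D^2u=\frac{h(x)}{\prod_{i=1}^Nl_i(x)}\ \text{ in }P,\qquad u(x)-\sum_{i=1}^Nl_i(x)\ln l_i(x)\in C^\infty(\overline P).$$ Then $$h(0)=l_{n+1}(0)\cdots l_N(0).$$
   Context: A polytope in $\mathbb R^n$ is simple if every vertex is contained in exactly $n$ codimension-one faces. The affine functions $l_1,\dots,l_N$ correspond one-to-one to the codimension-one faces of $P$. *)

theory Defs
  imports "HOL-Analysis.Analysis"
begin

definition affine_function :: "(real^'n \<Rightarrow> real) \<Rightarrow> bool" where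
  "affine_function l \<longleftrightarrow> (\<exists>a b. \<forall>x. l x = a \<bullet> x + b)"

definition simple_polytope :: "(real^'n) set \<Rightarrow> bool" where
  "simple_polytope Q \<longleftrightarrow> polytope Q \<and>
     (\<forall>v. v extreme_point_of Q \<longrightarrow> card {F. F facet_of Q \<and> v \<in> F} = CARD('n))"

definition partial_deriv :: "'n \<Rightarrow> (real^'n \<Rightarrow> real) \<Rightarrow> real^'n \<Rightarrow> real" where
  "partial_deriv i f x = frechet_derivative f (at x) (axis i 1)"

definition hessian :: "(real^'n \<Rightarrow> real) \<Rightarrow> real^'n \<Rightarrow> real^'n^'n" where
  "hessian f x = (\<chi> i j. partial_deriv i (partial_deriv j f) x)"

text \<open>
  \<open>C_infinity_closure \<Omega>\<close> is $C^\infty(\overline\Omega)$ for an open set \<open>\<Omega>\<close>: a function on the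
  closure that is smooth in \<open>\<Omega>\<close> and all of whose partial derivatives, of every order, extend
  continuously from \<open>\<Omega>\<close> to the closure. The list \<open>ds\<close> records the directions of differentiation;
  the function itself is required to be its own continuous extension, so that its boundary
  values are meaningful.
\<close>
definition C_infinity_closure :: "(real^'n) set \<Rightarrow> (real^'n \<Rightarrow> real) set" where
  "C_infinity_closure \<Omega> = {f. continuous_on (closure \<Omega>) f \<and>
     (\<forall>ds :: 'n list.
        (\<forall>x\<in>\<Omega>. foldr partial_deriv ds f differentiable (at x)) \<and>
        (\<exists>g. continuous_on (closure \<Omega>) g \<and> (\<forall>x\<in>\<Omega>. g x = foldr partial_deriv ds f x)))}"

end

theory Submission
  imports Defs
begin

text \<open>
  Near the vertex the coordinate facets alone decide the leading behaviour of \<open>det (hessian u)\<close>. With \<open>a\<^sub>k\<close> the gradient of \<open>l k\<close>, the Hessian of \<open>u\<close> in \<open>P\<close> is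
  \<open>\<Sum>k. a\<^sub>k a\<^sub>k\<^sup>T / l k\<close> plus a matrix that extends continuously to the closure
  (\<open>hessian_affine_entropy_plus\<close>). Simplicity at the vertex \<open>0\<close> says that the \<open>n\<close> coordinate
  facets are the only ones through \<open>0\<close>, so every other \<open>l k\<close> is positive there
  (\<open>simple_polytope_other_facets_avoid_vertex\<close>), and the only singular part of the Hessian at \<open>0\<close>
  is the diagonal matrix with entries \<open>1 / x $ i\<close>.

  Multiplying row \<open>i\<close> by \<open>x $ i\<close> turns that diagonal part into the identity and makes the rest
  tend to zero. The determinant of the rescaled matrix therefore tends to \<open>1\<close>. By the equation it
  also equals \<open>h x / (\<Prod>k>n. l k x)\<close>, because the factors \<open>x $ i\<close> cancel against the first \<open>n\<close>
  factors of the denominator. Comparing the limits at \<open>0\<close> gives the claim.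
\<close>

section \<open>The Hessian of the logarithmic part\<close>

lemma partial_deriv_eqI:
  assumes "(f has_derivative f') (at x)"
  shows "partial_deriv i f x = f' (axis i 1)"
  using frechet_derivative_at[OF assms] by (simp add: partial_deriv_def)

lemma partial_deriv_cong_open:
  assumes "open S" "x \<in> S" "\<And>y. y \<in> S \<Longrightarrow> f y = g y"
  shows "partial_deriv i f x = partial_deriv i g x"
proof -
  have "(f has_derivative D) (at x) \<longleftrightarrow> (g has_derivative D) (at x)" for D
    using assms has_derivative_transform_within_open[of f D x UNIV S g]
      has_derivative_transform_within_open[of g D x UNIV S f] by auto
  then show ?thesis
    by (simp add: partial_deriv_def frechet_derivative_def)
qed

lemma partial_deriv_add:
  assumes "f differentiable at x" "g differentiable at x"
  shows "partial_deriv i (\<lambda>y. f y + g y) x = partial_deriv i f x + partial_deriv i g x"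
  by (rule partial_deriv_eqI[where f' = "\<lambda>h. frechet_derivative f (at x) h + frechet_derivative g (at x) h",
        unfolded partial_deriv_def[symmetric]])
     (use assms in \<open>auto intro!: has_derivative_add simp: frechet_derivative_works[symmetric]\<close>)

context
  fixes a :: "'k \<Rightarrow> real^'n" and b :: "'k \<Rightarrow> real" and K :: "'k set" and S :: "(real^'n) set"
  assumes pos: "\<And>k x. k \<in> K \<Longrightarrow> x \<in> S \<Longrightarrow> 0 < a k \<bullet> x + b k"
begin

lemma has_derivative_affine_entropy:
  assumes "x \<in> S"
  shows "((\<lambda>x. \<Sum>k\<in>K. (a k \<bullet> x + b k) * ln (a k \<bullet> x + b k)) has_derivative
           (\<lambda>v. \<Sum>k\<in>K. (a k \<bullet> v) * (ln (a k \<bullet> x + b k) + 1))) (at x)"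
proof (rule has_derivative_sum)
  fix k assume "k \<in> K"
  with assms pos have "0 < a k \<bullet> x + b k" by blast
  then show "((\<lambda>x. (a k \<bullet> x + b k) * ln (a k \<bullet> x + b k)) has_derivative
           (\<lambda>v. (a k \<bullet> v) * (ln (a k \<bullet> x + b k) + 1))) (at x)"
    by (auto intro!: derivative_eq_intros simp: fun_eq_iff distrib_left)
qed

lemma has_derivative_partial_affine_entropy:
  assumes "x \<in> S"
  shows "((\<lambda>x. \<Sum>k\<in>K. a k $ j * (ln (a k \<bullet> x + b k) + 1)) has_derivative
           (\<lambda>v. \<Sum>k\<in>K. a k $ j * (a k \<bullet> v) / (a k \<bullet> x + b k))) (at x)"
proof (rule has_derivative_sum)
  fix k assume "k \<in> K"
  with assms pos have "0 < a k \<bullet> x + b k" by blast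
  then show "((\<lambda>x. a k $ j * (ln (a k \<bullet> x + b k) + 1)) has_derivative
           (\<lambda>v. a k $ j * (a k \<bullet> v) / (a k \<bullet> x + b k))) (at x)"
    by (auto intro!: derivative_eq_intros simp: fun_eq_iff field_simps)
qed

text \<open>
  Since \<open>t ln t\<close> has second derivative \<open>1 / t\<close>, each summand contributes the rank-one matrix
  \<open>a\<^sub>k a\<^sub>k\<^sup>T / l k\<close>. Values of \<open>u\<close> outside the open set \<open>S\<close> do not affect derivatives in \<open>S\<close>.
\<close>

lemma hessian_affine_entropy_plus:
  assumes "open S" "x \<in> S"
    and u: "\<And>y. y \<in> S \<Longrightarrow> u y = (\<Sum>k\<in>K. (a k \<bullet> y + b k) * ln (a k \<bullet> y + b k)) + g y"
    and g: "\<And>y. y \<in> S \<Longrightarrow> g differentiable at y"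
    and g': "\<And>y. y \<in> S \<Longrightarrow> partial_deriv j g differentiable at y"
  shows "hessian u x $ i $ j =
           (\<Sum>k\<in>K. a k $ i * a k $ j / (a k \<bullet> x + b k)) + partial_deriv i (partial_deriv j g) x"
proof -
  have first: "partial_deriv j u y =
      (\<Sum>k\<in>K. a k $ j * (ln (a k \<bullet> y + b k) + 1)) + partial_deriv j g y" if "y \<in> S" for y
  proof -
    note D = has_derivative_affine_entropy[OF that]
    have "partial_deriv j u y = partial_deriv j
        (\<lambda>y. (\<Sum>k\<in>K. (a k \<bullet> y + b k) * ln (a k \<bullet> y + b k)) + g y) y"
      by (rule partial_deriv_cong_open[OF \<open>open S\<close> that u])
    then show ?thesis
      using partial_deriv_add[OF differentiableI[OF D] g[OF that], of j] partial_deriv_eqI[OF D, of j]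
      by (simp add: inner_axis)
  qed
  note D = has_derivative_partial_affine_entropy[OF \<open>x \<in> S\<close>, of j]
  have "partial_deriv i (partial_deriv j u) x = partial_deriv i
      (\<lambda>y. (\<Sum>k\<in>K. a k $ j * (ln (a k \<bullet> y + b k) + 1)) + partial_deriv j g y) x"
    by (rule partial_deriv_cong_open[OF \<open>open S\<close> \<open>x \<in> S\<close> first])
  then show ?thesis
    using partial_deriv_add[OF differentiableI[OF D] g'[OF \<open>x \<in> S\<close>], of i] partial_deriv_eqI[OF D, of i]
    by (simp add: hessian_def inner_axis mult.commute)
qed

end

section \<open>Facets through a simple vertex\<close>

text \<open>
  Distinct indices give distinct facets, and the \<open>CARD('n)\<close> indices in \<open>J\<close> already use up all the
  facets that a simple polytope has through \<open>v\<close>; one more would exceed the count.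
\<close>

lemma simple_polytope_other_facets_avoid_vertex:
  fixes Q :: "(real^'n) set" and l :: "'k \<Rightarrow> real^'n \<Rightarrow> real"
  assumes "simple_polytope Q" and v: "v extreme_point_of Q"
    and bij: "bij_betw (\<lambda>i. {x \<in> Q. l i x = 0}) I {F. F facet_of Q}"
    and "J \<subseteq> I" "card J = CARD('n)" and J0: "\<And>i. i \<in> J \<Longrightarrow> l i v = 0"
    and i: "i \<in> I - J"
  shows "l i v \<noteq> 0"
proof
  assume "l i v = 0"
  let ?face = "\<lambda>i. {x \<in> Q. l i x = 0}"
  have "v \<in> Q" using v by (simp add: extreme_point_of_def)
  have card: "card {F. F facet_of Q \<and> v \<in> F} = CARD('n)"
    using assms(1) v by (simp add: simple_polytope_def)
  then have fin: "finite {F. F facet_of Q \<and> v \<in> F}"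
    by (intro card_ge_0_finite) simp
  have "finite J" using \<open>card J = CARD('n)\<close> by (intro card_ge_0_finite) simp
  have inj: "inj_on ?face (insert i J)"
    using bij i \<open>J \<subseteq> I\<close> inj_on_subset[of ?face I "insert i J"] by (simp add: bij_betw_def)
  have "?face ` insert i J \<subseteq> {F. F facet_of Q \<and> v \<in> F}"
  proof
    fix F assume "F \<in> ?face ` insert i J"
    then obtain k where k: "k \<in> insert i J" "F = ?face k" by blast
    then have "F \<in> ?face ` I" using i \<open>J \<subseteq> I\<close> by blast
    then have "F facet_of Q" using bij by (simp add: bij_betw_def)
    moreover have "v \<in> F" using k \<open>l i v = 0\<close> J0 \<open>v \<in> Q\<close> by auto
    ultimately show "F \<in> {F. F facet_of Q \<and> v \<in> F}" by blast
  qed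
  then have "card (insert i J) \<le> CARD('n)"
    using card_mono[OF fin, of "?face ` insert i J"] unfolding card_image[OF inj] card by blast
  then show False
    using i \<open>finite J\<close> \<open>card J = CARD('n)\<close> by simp
qed

section \<open>The rescaled determinant\<close>

lemma tendsto_det:
  fixes M :: "'a \<Rightarrow> real^'n^'n"
  assumes "\<And>i j. ((\<lambda>x. M x $ i $ j) \<longlongrightarrow> L $ i $ j) F"
  shows "((\<lambda>x. det (M x)) \<longlongrightarrow> det L) F"
  unfolding det_def by (intro tendsto_sum tendsto_mult tendsto_const tendsto_prod assms)

theorem lemma2p1:
  fixes l :: "nat \<Rightarrow> real^'n \<Rightarrow> real"
    and N :: nat
    and e :: "'n \<Rightarrow> nat"
    and P :: "(real^'n) set"
    and h u :: "real^'n \<Rightarrow> real"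
  assumes "\<And>i. i \<in> {1..N} \<Longrightarrow> affine_function (l i)"
    and "P = (\<Inter>i\<in>{1..N}. {x. l i x > 0})"
    and "simple_polytope (closure P)"
    and "bij_betw (\<lambda>i. {x \<in> closure P. l i x = 0}) {1..N} {F. F facet_of closure P}"
    and "CARD('n) \<le> N"
    and "bij_betw e UNIV {1..CARD('n)}"
    and "\<And>k x. l (e k) x = x $ k"
    and "0 extreme_point_of closure P"
    and "h \<in> C_infinity_closure P"
    and "\<And>x. x \<in> closure P \<Longrightarrow> 0 < h x"
    and "\<And>x. x \<in> P \<Longrightarrow> det (hessian u x) = h x / (\<Prod>i=1..N. l i x)"
    and "\<exists>g\<in>C_infinity_closure P. \<forall>x\<in>P. u x - (\<Sum>i=1..N. l i x * ln (l i x)) = g x"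
  shows "h 0 = (\<Prod>i=CARD('n)+1..N. l i 0)"
proof -
  let ?n = "CARD('n)"
  define F where "F = at (0 :: real^'n) within P"
  have "\<exists>a b. \<forall>i\<in>{1..N}. \<forall>x. l i x = a i \<bullet> x + b i"
    using assms(1) unfolding affine_function_def by metis
  then obtain a b where l: "\<And>i x. i \<in> {1..N} \<Longrightarrow> l i x = a i \<bullet> x + b i" by blast
  have e_in: "e k \<in> {1..?n}" "e k \<in> {1..N}" for k
    using assms(5) bij_betwE[OF assms(6)] by (auto intro: order_trans)
  have split_index: "{1..N} = {1..?n} \<union> {?n+1..N}" using assms(5) by auto

  have cont_l: "continuous_on UNIV (l i)" if "i \<in> {1..N}" for i
    by (subst continuous_on_cong[OF refl l[OF that]]) (auto intro!: continuous_intros)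
  have P_pos: "0 < l i x" if "i \<in> {1..N}" "x \<in> P" for i x
    using that assms(2) by auto
  have "open P"
    unfolding assms(2) using cont_l
    by (intro open_INT ballI open_Collect_less) (auto intro!: continuous_intros)

  have "0 \<in> closure P" using assms(8) by (simp add: extreme_point_of_def)
  \<comment> \<open>The coordinate functions vanish at \<open>0\<close>, so \<open>0\<close> is approached from \<open>P\<close> without belonging to it.\<close>
  moreover have "0 \<notin> P"
    using P_pos[OF e_in(2)] assms(7) by (metis less_irrefl zero_index)
  ultimately have F_nontrivial: "F \<noteq> bot"
    by (simp add: F_def trivial_limit_within closure_def)
  have in_P: "\<forall>\<^sub>F x in F. x \<in> P"
    by (simp add: F_def eventually_at_filter)
  have limit_at_0: "(f \<longlongrightarrow> f 0) F" if "continuous_on (closure P) f" for f :: "real^'n \<Rightarrow> real"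
    using that \<open>0 \<in> closure P\<close> closure_subset[of P]
    unfolding F_def continuous_on_def by (blast intro: tendsto_within_subset)
  have l_limit: "(l i \<longlongrightarrow> l i 0) F" if "i \<in> {1..N}" for i
    using limit_at_0 cont_l[OF that] continuous_on_subset by blast
  have l_e: "l (e i) = (\<lambda>x. x $ i)" for i
    using assms(7) by blast
  have x_limit: "((\<lambda>x. x $ i) \<longlongrightarrow> 0) F" for i
    using l_limit[OF e_in(2)[of i]] by (simp add: l_e)

  have other_pos: "0 < l i 0" if "i \<in> {?n+1..N}" for i
  proof -
    have "l i 0 \<noteq> 0"
    proof (rule simple_polytope_other_facets_avoid_vertex[OF assms(3,8,4), where J = "{1..?n}"])
      show "l j 0 = 0" if "j \<in> {1..?n}" for j
        using that assms(6,7) by (metis bij_betw_imp_surj_on imageE zero_index)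
    qed (use that assms(5) in auto)
    moreover have "0 \<le> l i 0"
    proof (rule tendsto_lowerbound[OF l_limit _ F_nontrivial])
      show "i \<in> {1..N}" using that by auto
      then show "\<forall>\<^sub>F x in F. 0 \<le> l i x"
        using in_P P_pos by (auto elim!: eventually_mono intro: less_imp_le)
    qed
    ultimately show ?thesis by simp
  qed

  have a_coord: "a (e k) $ i = (if k = i then 1 else 0)" for k i
  proof -
    have "a (e k) \<bullet> x + b (e k) = x $ k" for x
      using l[OF e_in(2)] assms(7) by simp
    from this[of "axis i 1"] this[of 0] show ?thesis
      unfolding inner_axis by (simp add: axis_def)
  qed

  obtain g where g: "g \<in> C_infinity_closure P"
    and u: "\<And>x. x \<in> P \<Longrightarrow> u x - (\<Sum>i=1..N. l i x * ln (l i x)) = g x"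
    using assms(12) by blast
  have g_diff: "foldr partial_deriv ds g differentiable at x" if "x \<in> P" for ds x
    using g that by (simp add: C_infinity_closure_def)
  have "\<forall>ds. \<exists>G. continuous_on (closure P) G \<and> (\<forall>x\<in>P. G x = foldr partial_deriv ds g x)"
    using g by (simp add: C_infinity_closure_def)
  then obtain E where E: "\<And>ds. continuous_on (closure P) (E ds)"
      "\<And>ds x. x \<in> P \<Longrightarrow> E ds x = foldr partial_deriv ds g x"
    by metis
  define G where "G i j = E [i, j]" for i j
  have G_cont: "\<And>i j. continuous_on (closure P) (G i j)"
    and G: "\<And>i j x. x \<in> P \<Longrightarrow> G i j x = partial_deriv i (partial_deriv j g) x"
    by (simp_all add: G_def E)

  \<comment> \<open>\<open>R\<close> collects the part of the Hessian that has a limit at \<open>0\<close>: the smooth remainder and the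
      facets that miss \<open>0\<close>.\<close>
  define R where "R i j x = (\<Sum>k\<in>{?n+1..N}. a k $ i * a k $ j / l k x) + G i j x" for i j x
  have hess: "hessian u x $ i $ j = (if i = j then 1 / x $ i else 0) + R i j x" if "x \<in> P" for x i j
  proof -
    have "hessian u x $ i $ j = (\<Sum>k\<in>{1..N}. a k $ i * a k $ j / (a k \<bullet> x + b k)) + G i j x"
      unfolding G[OF that]
    proof (rule hessian_affine_entropy_plus[OF _ \<open>open P\<close> that])
      show "0 < a k \<bullet> y + b k" if "k \<in> {1..N}" "y \<in> P" for k y
        using P_pos[OF that] l[OF that(1)] by simp
      show "u y = (\<Sum>k\<in>{1..N}. (a k \<bullet> y + b k) * ln (a k \<bullet> y + b k)) + g y" if "y \<in> P" for y
        using u[OF that] l by (simp add: algebra_simps)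
    qed (use g_diff[of _ "[]"] g_diff[of _ "[j]"] in auto)
    also have "(\<Sum>k\<in>{1..N}. a k $ i * a k $ j / (a k \<bullet> x + b k)) = (\<Sum>k\<in>{1..N}. a k $ i * a k $ j / l k x)"
      by (rule sum.cong) (auto simp: l)
    also have "\<dots> = (\<Sum>k\<in>{1..?n}. a k $ i * a k $ j / l k x) + (\<Sum>k\<in>{?n+1..N}. a k $ i * a k $ j / l k x)"
      unfolding split_index by (rule sum.union_disjoint) auto
    also have "(\<Sum>k\<in>{1..?n}. a k $ i * a k $ j / l k x) = (\<Sum>k\<in>UNIV. a (e k) $ i * a (e k) $ j / l (e k) x)"
      by (rule sum.reindex_bij_betw[OF assms(6), symmetric])
    also have "\<dots> = (\<Sum>k\<in>UNIV. if k = i then (if i = j then 1 / x $ i else 0) else 0)"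
      by (rule sum.cong) (auto simp: a_coord assms(7))
    finally show ?thesis by (simp add: R_def add.assoc)
  qed

  have R_limit: "(R i j \<longlongrightarrow> R i j 0) F" for i j
    unfolding R_def
    by (intro tendsto_intros l_limit limit_at_0 G_cont) (use other_pos in force)+

  \<comment> \<open>The singular part of the Hessian is diagonal, so scaling row \<open>i\<close> by \<open>x $ i\<close>
      leaves the identity plus terms of size \<open>O(x)\<close>.\<close>
  define M :: "real^'n \<Rightarrow> real^'n^'n" where "M x = (\<chi> i. x $ i *s (hessian u x $ i))" for x
  have "((\<lambda>x. M x $ i $ j) \<longlongrightarrow> mat 1 $ i $ j) F" for i j
  proof -
    have "((\<lambda>x. (if i = j then 1 else 0) + x $ i * R i j x) \<longlongrightarrow> (if i = j then 1 else 0) + 0 * R i j 0) F"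
      by (intro tendsto_intros x_limit R_limit)
    moreover have "\<forall>\<^sub>F x in F. (if i = j then 1 else 0) + x $ i * R i j x = M x $ i $ j"
      using in_P
    proof eventually_elim
      case (elim x)
      have "x $ i \<noteq> 0" using P_pos[OF e_in(2)[of i] elim] assms(7) by simp
      then show ?case by (auto simp: M_def hess[OF elim] distrib_left)
    qed
    ultimately show ?thesis
      by (simp add: tendsto_cong mat_def)
  qed
  then have "((\<lambda>x. det (M x)) \<longlongrightarrow> 1) F"
    using tendsto_det[of M "mat 1" F] by simp
  moreover have "\<forall>\<^sub>F x in F. det (M x) = h x / (\<Prod>i=?n+1..N. l i x)"
    using in_P
  proof eventually_elim
    case (elim x)
    have coord_prod: "(\<Prod>i=1..?n. l i x) = (\<Prod>i\<in>UNIV. x $ i)"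
      using prod.reindex_bij_betw[OF assms(6), of "\<lambda>i. l i x"] assms(7) by simp
    have "(\<Prod>i=1..N. l i x) = (\<Prod>i=1..?n. l i x) * (\<Prod>i=?n+1..N. l i x)"
      unfolding split_index by (rule prod.union_disjoint) auto
    moreover have "(\<Prod>i=1..?n. l i x) \<noteq> 0"
      using P_pos[OF _ elim] assms(5) by (force simp: prod_zero_iff)
    moreover have "det (M x) = (\<Prod>i\<in>UNIV. x $ i) * det (hessian u x)"
      unfolding M_def using det_rows_mul[of "\<lambda>i. x $ i" "\<lambda>i. hessian u x $ i"]
      by (simp add: vec_lambda_eta)
    ultimately show ?case
      by (simp add: assms(11)[OF elim] coord_prod[symmetric] del: prod_zero_iff)
  qed
  ultimately have "((\<lambda>x. h x / (\<Prod>i=?n+1..N. l i x)) \<longlongrightarrow> 1) F"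
    by (simp add: tendsto_cong)
  moreover have "((\<lambda>x. h x / (\<Prod>i=?n+1..N. l i x)) \<longlongrightarrow> h 0 / (\<Prod>i=?n+1..N. l i 0)) F"
  proof (intro tendsto_divide tendsto_prod l_limit limit_at_0)
    show "continuous_on (closure P) h"
      using assms(9) by (simp add: C_infinity_closure_def)
    show "(\<Prod>i=?n+1..N. l i 0) \<noteq> 0"
      using other_pos by (force simp: prod_zero_iff)
  qed auto
  ultimately have "h 0 / (\<Prod>i=?n+1..N. l i 0) = 1"
    using tendsto_unique[OF F_nontrivial] by blast
  then show ?thesis by (simp add: divide_eq_1_iff)
qed

end
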